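(* For $\alpha\in\mathbb{R}$, define $f_\alpha:(0,1]\to\mathbb{R}$ by $$f_\alpha(x)=\Bigl(\alpha+\sqrt{1-x^2}\Bigr)\frac{\arcsin x}{x}.$$ Then: (1) $f_\alpha$ is strictly increasing on $(0,1]$ if and only if $\alpha\ge 2$; (2) $f_\alpha$ is strictly decreasing on $(0,1]$ if and only if $\alpha\le\frac{\pi}{2}$. Moreover, when $\frac{\pi}{2}<\alpha<2$, the function $f_\alpha$ has a unique minimum on $(0,1)$, i.e. there is exactly one point $x_0\in(0,1)$ such that $f_\alpha(x_0)\le f_\alpha(x)$ for all $x\in(0,1)$.
   Context: Here $\arcsin:[-1,1]\to[-\pi/2,\pi/2]$ is the principal branch of the inverse sine function. *)

theory Defs
  imports "HOL-Analysis.Analysis"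
begin

(* Only values at x in (0,1] are meaningful; HOL functions are total, so the
   domain is imposed where the function is used. *)
definition f_alpha :: "real \<Rightarrow> real \<Rightarrow> real" where
  "f_alpha \<alpha> x = (\<alpha> + sqrt (1 - x\<^sup>2)) * (arcsin x / x)"

end

theory Submission
  imports Defs "HOL-Real_Asymp.Real_Asymp"
begin

(* Substituting x = sin t with 0 < t <= pi/2 turns f_alpha into
   g t = (alpha + cos t) * t / sin t, and
   g' t = (sin t - t * cos t) * (alpha - h t) / (sin t)^2
   with h t = (t - sin t * cos t) / (sin t - t * cos t).
   The function h decreases strictly from its limit 2 at 0 to h (pi/2) = pi/2, so g is
   increasing for alpha >= 2, decreasing for alpha <= pi/2, and in between it decreases up to
   the point where h takes the value alpha and increases afterwards. *)

section \<open>Elementary trigonometric inequalities\<close>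

text \<open>The mean value argument in reusable form: an inequality between expressions agreeing at
  0 is reduced to the sign of a derivative, repeatedly if necessary.\<close>

lemma pos_if_deriv_pos:
  fixes f f' :: "real \<Rightarrow> real"
  assumes "\<And>x. (f has_real_derivative f' x) (at x)"
    and "f 0 = 0" "0 < u" "\<And>x. 0 < x \<Longrightarrow> x < u \<Longrightarrow> 0 < f' x"
  shows "0 < f u"
proof -
  have "f 0 < f u"
  proof (rule DERIV_pos_imp_increasing_open[of 0 u f])
    show "continuous_on {0..u} f"
      using assms(1) by (meson DERIV_isCont continuous_at_imp_continuous_on)
  qed (use assms in blast)+
  then show ?thesis using assms(2) by simp
qed

text \<open>The derivative is \<open>u * sin u\<close>. The expression is both the denominator of
  \<open>h\<close> and a factor of the derivative of \<open>g\<close>.\<close>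

lemma sin_minus_mult_cos_pos:
  assumes "0 < u" "u \<le> pi"
  shows "0 < sin u - u * cos (u::real)"
proof (rule pos_if_deriv_pos[of "\<lambda>u. sin u - u * cos u" "\<lambda>u. u * sin u"])
  show "((\<lambda>u. sin u - u * cos u) has_real_derivative x * sin x) (at x)" for x :: real
    by (auto intro!: derivative_eq_intros)
qed (use assms in \<open>auto intro!: mult_pos_pos sin_gt_zero\<close>)

lemma sin_sq_bound:
  assumes "0 < t" "t \<le> pi / 2"
  shows "0 < t\<^sup>2 + t * sin t * cos t - 2 * (sin t)\<^sup>2"
proof -
  \<comment> \<open>In terms of \<open>u = 2 * t\<close> the claim is \<open>0 < u\<^sup>2 + u * sin u - 4 + 4 * cos u\<close>; three
    derivatives lead to \<open>sin u - u * cos u\<close>, and all of them vanish at \<open>0\<close>.\<close>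
  have 2: "0 < 2 - 2 * cos u - u * sin u" if "0 < u" "u \<le> pi" for u :: real
  proof (rule pos_if_deriv_pos[of "\<lambda>u. 2 - 2 * cos u - u * sin u"
        "\<lambda>u. sin u - u * cos u"])
    show "((\<lambda>u. 2 - 2 * cos u - u * sin u) has_real_derivative sin x - x * cos x) (at x)" for x :: real
      by (auto intro!: derivative_eq_intros)
  qed (use that sin_minus_mult_cos_pos in auto)
  have 1: "0 < 2 * u - 3 * sin u + u * cos u" if "0 < u" "u \<le> pi" for u :: real
  proof (rule pos_if_deriv_pos[of "\<lambda>u. 2 * u - 3 * sin u + u * cos u"
        "\<lambda>u. 2 - 2 * cos u - u * sin u"])
    show "((\<lambda>u. 2 * u - 3 * sin u + u * cos u) has_real_derivative 2 - 2 * cos x - x * sin x) (at x)"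
      for x :: real
      by (auto intro!: derivative_eq_intros)
  qed (use that 2 in auto)
  have 0: "0 < u\<^sup>2 + u * sin u - 4 + 4 * cos u" if "0 < u" "u \<le> pi" for u :: real
  proof (rule pos_if_deriv_pos[of "\<lambda>u. u\<^sup>2 + u * sin u - 4 + 4 * cos u"
        "\<lambda>u. 2 * u - 3 * sin u + u * cos u"])
    show "((\<lambda>u. u\<^sup>2 + u * sin u - 4 + 4 * cos u) has_real_derivative
        2 * x - 3 * sin x + x * cos x) (at x)" for x :: real
      by (auto intro!: derivative_eq_intros)
  qed (use that 1 in auto)
  have "0 < (2 * t)\<^sup>2 + 2 * t * sin (2 * t) - 4 + 4 * cos (2 * t)"
    using 0[of "2 * t"] assms by simp
  also have "\<dots> = 4 * (t\<^sup>2 + t * sin t * cos t - 2 * (sin t)\<^sup>2)"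
    unfolding sin_double cos_double_sin by (simp add: power2_eq_square algebra_simps)
  finally show ?thesis by simp
qed

section \<open>Monotonicity and range of \<open>h\<close>\<close>

definition h :: "real \<Rightarrow> real" where
  "h t = (t - sin t * cos t) / (sin t - t * cos t)"

text \<open>After \<open>(cos t)\<^sup>2\<close> is eliminated, the numerator of the quotient rule
  factors into \<open>- sin t\<close> times the expression bounded in \<open>sin_sq_bound\<close>,
  which makes the sign visible.\<close>

lemma h_has_real_derivative:
  assumes "0 < t" "t \<le> pi / 2"
  shows "(h has_real_derivative
    - (sin t * (t\<^sup>2 + t * sin t * cos t - 2 * (sin t)\<^sup>2)) / (sin t - t * cos t)\<^sup>2) (at t)"
proof -
  have D: "sin t - t * cos t \<noteq> 0"
    using sin_minus_mult_cos_pos[of t] assms by auto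
  have c: "(cos t)\<^sup>2 = 1 - (sin t)\<^sup>2"
    by (rule cos_squared_eq)
  have "(h has_real_derivative
      ((1 - ((cos t)\<^sup>2 - (sin t)\<^sup>2)) * (sin t - t * cos t) - (t - sin t * cos t) * (t * sin t))
        / (sin t - t * cos t)\<^sup>2) (at t)"
    unfolding h_def using D
    by (auto intro!: derivative_eq_intros simp: power2_eq_square algebra_simps)
  moreover have "(1 - ((cos t)\<^sup>2 - (sin t)\<^sup>2)) * (sin t - t * cos t) - (t - sin t * cos t) * (t * sin t)
      = - (sin t * (t\<^sup>2 + t * sin t * cos t - 2 * (sin t)\<^sup>2))"
    unfolding c by algebra
  ultimately show ?thesis by simp
qed

lemma continuous_on_h: "continuous_on {0<..pi / 2} h"
  by (auto intro!: continuous_at_imp_continuous_on DERIV_isCont h_has_real_derivative)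

text \<open>The derivative is negative by \<open>sin_sq_bound\<close>. The right end is included so
  that values can be compared with \<open>h (pi / 2)\<close>.\<close>

lemma h_strict_antimono: "strict_antimono_on {0<..pi / 2} h"
proof (rule monotone_onI)
  fix s t :: real
  assume st: "s \<in> {0<..pi / 2}" "t \<in> {0<..pi / 2}" "s < t"
  show "h t < h s"
  proof (rule DERIV_neg_imp_decreasing_open[of s t h])
    show "continuous_on {s..t} h"
      by (rule continuous_on_subset[OF continuous_on_h]) (use st in auto)
  next
    fix x assume x: "s < x" "x < t"
    with st have x': "0 < x" "x \<le> pi / 2" by auto
    then have "0 < sin x"
      by (intro sin_gt_zero) auto
    with x' have "- (sin x * (x\<^sup>2 + x * sin x * cos x - 2 * (sin x)\<^sup>2)) / (sin x - x * cos x)\<^sup>2 < 0"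
      using sin_sq_bound[of x] sin_minus_mult_cos_pos[of x]
      by (intro divide_neg_pos) auto
    with h_has_real_derivative[OF x'] show "\<exists>y. (h has_real_derivative y) (at x) \<and> y < 0"
      by blast
  qed (use st in auto)
qed

text \<open>Near 0 the numerator behaves like \<open>2 * t^3 / 3\<close> and the denominator like
  \<open>t^3 / 3\<close>.\<close>

lemma h_tendsto_2: "(h \<longlongrightarrow> 2) (at_right 0)"
  unfolding h_def by real_asymp

lemma h_pi_half: "h (pi / 2) = pi / 2"
  by (simp add: h_def)

text \<open>The limit at 0 alone gives only a weak bound; applying it at \<open>t / 2\<close> and
  then using strict decrease makes it strict.\<close>

lemma h_lt_2:
  assumes "0 < t" "t \<le> pi / 2"
  shows "h t < 2"
proof -
  have "h t < h (t / 2)"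
    using assms by (intro monotone_onD[OF h_strict_antimono]) auto
  also have "h (t / 2) \<le> 2"
  proof (rule tendsto_lowerbound[OF h_tendsto_2])
    have "\<forall>\<^sub>F s in at_right 0. 0 < s \<and> s < t / 2"
      using eventually_at_right_real[of 0 "t / 2"] assms by simp
    then show "\<forall>\<^sub>F s in at_right 0. h (t / 2) \<le> h s"
    proof eventually_elim
      case (elim s)
      then show ?case
        using assms by (intro less_imp_le monotone_onD[OF h_strict_antimono]) auto
    qed
  qed simp
  finally show ?thesis .
qed

text \<open>Intermediate value theorem between a point near 0, where \<open>h\<close> is still above
  \<alpha>, and \<open>pi / 2\<close>, where it is below.\<close>

lemma h_surj:
  assumes "pi / 2 < \<alpha>" "\<alpha> < 2"
  obtains t where "0 < t" "t < pi / 2" "h t = \<alpha>"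
proof -
  have "\<forall>\<^sub>F s in at_right 0. \<alpha> < h s"
    using order_tendstoD(1)[OF h_tendsto_2 assms(2)] .
  moreover have "\<forall>\<^sub>F s in at_right 0. 0 < s \<and> s < pi / 2"
    using eventually_at_right_real[of 0 "pi / 2"] by simp
  ultimately have "\<forall>\<^sub>F s in at_right 0. \<alpha> < h s \<and> 0 < s \<and> s < pi / 2"
    by eventually_elim auto
  then obtain s where s: "\<alpha> < h s" "0 < s" "s < pi / 2"
    using eventually_happens[of _ "at_right (0::real)"] by (auto simp: trivial_limit_at_right_real)
  have "\<exists>t\<ge>s. t \<le> pi / 2 \<and> h t = \<alpha>"
  proof (rule IVT2')
    show "continuous_on {s..pi / 2} h"
      by (rule continuous_on_subset[OF continuous_on_h]) (use s in auto)
  qed (use s assms h_pi_half in auto)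
  then obtain t where t: "s \<le> t" "t \<le> pi / 2" "h t = \<alpha>" by blast
  moreover have "t \<noteq> pi / 2"
    using t(3) assms(1) h_pi_half by force
  ultimately show ?thesis using s that[of t] by auto
qed

section \<open>The substituted function \<open>g\<close> and the sign of its derivative\<close>

definition g :: "real \<Rightarrow> real \<Rightarrow> real" where
  "g \<alpha> t = (\<alpha> + cos t) * t / sin t"

lemma f_alpha_eq_g:
  assumes "0 < x" "x \<le> 1"
  shows "f_alpha \<alpha> x = g \<alpha> (arcsin x)"
  using assms by (simp add: f_alpha_def g_def cos_arcsin)

text \<open>In this factored form \<open>\<alpha> - h t\<close> is the only factor whose sign is not
  fixed on the interval.\<close>

lemma g_has_real_derivative:
  assumes "0 < t" "t \<le> pi / 2"
  shows "(g \<alpha> has_real_derivative (sin t - t * cos t) * (\<alpha> - h t) / (sin t)\<^sup>2) (at t)"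
proof -
  have s: "sin t \<noteq> 0"
    using sin_gt_zero[of t] assms by auto
  \<comment> \<open>Clearing the denominator of \<open>h\<close> leaves an identity free of
    quotients to compare with the quotient rule.\<close>
  have "(sin t - t * cos t) * h t = t - sin t * cos t"
    using sin_minus_mult_cos_pos[of t] assms by (simp add: h_def)
  then have eq: "(sin t - t * cos t) * (\<alpha> - h t) = (sin t - t * cos t) * \<alpha> - (t - sin t * cos t)"
    by (simp add: right_diff_distrib)
  have "(cos t)\<^sup>2 = 1 - (sin t)\<^sup>2"
    by (rule cos_squared_eq)
  then have t: "t * cos t * cos t = t - t * sin t * sin t"
    by (simp add: power2_eq_square right_diff_distrib mult.assoc)
  have "(g \<alpha> has_real_derivative
      (((\<alpha> + cos t) - t * sin t) * sin t - (\<alpha> + cos t) * t * cos t) / (sin t * sin t)) (at t)"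
    unfolding g_def using s by (auto intro!: derivative_eq_intros simp: algebra_simps)
  moreover have "((\<alpha> + cos t) - t * sin t) * sin t - (\<alpha> + cos t) * t * cos t
      = (sin t - t * cos t) * (\<alpha> - h t)"
    unfolding eq using t by (simp add: algebra_simps)
  ultimately show ?thesis by (simp add: power2_eq_square)
qed

lemma continuous_on_g: "continuous_on {0<..pi / 2} (g \<alpha>)"
  by (auto intro!: continuous_at_imp_continuous_on DERIV_isCont g_has_real_derivative)

text \<open>A bound at the right end suffices: \<open>h\<close> decreases strictly, so \<alpha> lies
  below \<open>h x\<close> at every interior \<open>x\<close>.\<close>

lemma g_decreasing:
  assumes "0 < s" "s < t" "t \<le> pi / 2" "\<alpha> \<le> h t"
  shows "g \<alpha> t < g \<alpha> s"
proof (rule DERIV_neg_imp_decreasing_open[of s t "g \<alpha>"])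
  show "continuous_on {s..t} (g \<alpha>)"
    by (rule continuous_on_subset[OF continuous_on_g]) (use assms in auto)
next
  fix x assume x: "s < x" "x < t"
  with assms have x': "0 < x" "x \<le> pi / 2" by auto
  have "\<alpha> < h x"
    using monotone_onD[OF h_strict_antimono, of x t] x x' assms by auto
  moreover have "0 < sin x"
    using x' by (intro sin_gt_zero) auto
  ultimately have "(sin x - x * cos x) * (\<alpha> - h x) / (sin x)\<^sup>2 < 0"
    using sin_minus_mult_cos_pos[of x] x' by (intro divide_neg_pos mult_pos_neg) auto
  with g_has_real_derivative[OF x'] show "\<exists>y. (g \<alpha> has_real_derivative y) (at x) \<and> y < 0"
    by blast
qed (use assms in auto)

text \<open>The bound is required only inside the interval, so \<open>s\<close> may be the point
  where \<open>h\<close> equals \<alpha>.\<close>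

lemma g_increasing:
  assumes "0 < s" "s < t" "t \<le> pi / 2" and h: "\<And>x. s < x \<Longrightarrow> x < t \<Longrightarrow> h x < \<alpha>"
  shows "g \<alpha> s < g \<alpha> t"
proof (rule DERIV_pos_imp_increasing_open[of s t "g \<alpha>"])
  show "continuous_on {s..t} (g \<alpha>)"
    by (rule continuous_on_subset[OF continuous_on_g]) (use assms in auto)
next
  fix x assume x: "s < x" "x < t"
  with assms have x': "0 < x" "x \<le> pi / 2" by auto
  have "0 < sin x"
    using x' by (intro sin_gt_zero) auto
  with h[OF x] have "0 < (sin x - x * cos x) * (\<alpha> - h x) / (sin x)\<^sup>2"
    using sin_minus_mult_cos_pos[of x] x' by (intro divide_pos_pos mult_pos_pos) auto
  with g_has_real_derivative[OF x'] show "\<exists>y. (g \<alpha> has_real_derivative y) (at x) \<and> y > 0"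
    by blast
qed (use assms in auto)

section \<open>Transfer back to \<open>f_alpha\<close> along the increasing substitution
  \<open>arcsin\<close>\<close>

lemma arcsin_pos_le_pi_half:
  assumes "0 < x" "x \<le> 1"
  shows "0 < arcsin x" "arcsin x \<le> pi / 2"
  using arcsin_less_mono[of 0 x] arcsin_ubound[of x] assms by auto

lemma f_alpha_strict_mono:
  assumes "2 \<le> \<alpha>"
  shows "strict_mono_on {0<..1} (f_alpha \<alpha>)"
proof (rule monotone_onI)
  fix x y :: real assume xy: "x \<in> {0<..1}" "y \<in> {0<..1}" "x < y"
  then have a: "0 < arcsin x" "arcsin x < arcsin y" "arcsin y \<le> pi / 2"
    using arcsin_pos_le_pi_half[of x] arcsin_pos_le_pi_half[of y] by (auto intro: arcsin_less_arcsin)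
  have "h t < \<alpha>" if "arcsin x < t" "t < arcsin y" for t
    using h_lt_2[of t] that a assms by linarith
  with g_increasing[OF a] show "f_alpha \<alpha> x < f_alpha \<alpha> y"
    using xy by (simp add: f_alpha_eq_g)
qed

lemma f_alpha_strict_antimono:
  assumes "\<alpha> \<le> pi / 2"
  shows "strict_antimono_on {0<..1} (f_alpha \<alpha>)"
proof (rule monotone_onI)
  fix x y :: real assume xy: "x \<in> {0<..1}" "y \<in> {0<..1}" "x < y"
  then have a: "0 < arcsin x" "arcsin x < arcsin y" "arcsin y \<le> pi / 2"
    using arcsin_pos_le_pi_half[of x] arcsin_pos_le_pi_half[of y] by (auto intro: arcsin_less_arcsin)
  \<comment> \<open>\<open>h\<close> attains its least value at \<open>pi / 2\<close>; the case
    split covers the endpoint, about which strict decrease says nothing.\<close>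
  have "pi / 2 \<le> h (arcsin y)"
    using monotone_onD[OF h_strict_antimono, of "arcsin y" "pi / 2"] a h_pi_half
    by (cases "arcsin y = pi / 2") (simp_all del: eq_divide_eq_numeral1)
  with assms a xy show "f_alpha \<alpha> y < f_alpha \<alpha> x"
    using g_decreasing[of "arcsin x" "arcsin y" \<alpha>] by (simp add: f_alpha_eq_g)
qed

text \<open>The turning point is the sine of the solution of \<open>h t = \<alpha>\<close>. Both
  intervals contain \<open>x0\<close>, so it can be compared strictly with points on either
  side.\<close>

lemma f_alpha_valley:
  assumes "pi / 2 < \<alpha>" "\<alpha> < 2"
  obtains x0 where "0 < x0" "x0 < 1"
    "strict_antimono_on {0<..x0} (f_alpha \<alpha>)" "strict_mono_on {x0..1} (f_alpha \<alpha>)"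
proof -
  obtain t where t: "0 < t" "t < pi / 2" "h t = \<alpha>"
    using h_surj[OF assms] .
  define x0 where "x0 = sin t"
  have x0: "0 < x0" "x0 < 1"
    using t sin_gt_zero[of t] sin_monotone_2pi[of t "pi / 2"] by (auto simp: x0_def)
  have arc: "arcsin x0 = t"
    using t by (simp add: x0_def arcsin_sin)
  have "strict_antimono_on {0<..x0} (f_alpha \<alpha>)"
  proof (rule monotone_onI)
    fix x y :: real assume xy: "x \<in> {0<..x0}" "y \<in> {0<..x0}" "x < y"
    then have a: "0 < arcsin x" "arcsin x < arcsin y" "arcsin y \<le> t"
      using arcsin_pos_le_pi_half[of x] arcsin_le_arcsin[of y x0] arc x0
      by (auto intro: arcsin_less_arcsin)
    have "\<alpha> \<le> h (arcsin y)"
      using monotone_onD[OF h_strict_antimono, of "arcsin y" t] a t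
      by (cases "arcsin y = t") auto
    with t a xy x0 show "f_alpha \<alpha> y < f_alpha \<alpha> x"
      using g_decreasing[of "arcsin x" "arcsin y" \<alpha>] by (simp add: f_alpha_eq_g)
  qed
  moreover have "strict_mono_on {x0..1} (f_alpha \<alpha>)"
  proof (rule monotone_onI)
    fix x y :: real assume xy: "x \<in> {x0..1}" "y \<in> {x0..1}" "x < y"
    then have a: "t \<le> arcsin x" "arcsin x < arcsin y" "arcsin y \<le> pi / 2"
      using arcsin_le_arcsin[of x0 x] arcsin_pos_le_pi_half[of y] arc x0
      by (auto intro: arcsin_less_arcsin)
    have "h s < \<alpha>" if "arcsin x < s" "s < arcsin y" for s
      using monotone_onD[OF h_strict_antimono, of t s] that a t by auto
    with a t xy x0 show "f_alpha \<alpha> x < f_alpha \<alpha> y"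
      using g_increasing[of "arcsin x" "arcsin y" \<alpha>] by (simp add: f_alpha_eq_g)
  qed
  ultimately show ?thesis using that x0 by blast
qed

text \<open>Supplies the "only if" directions: monotonicity in one sense, even on a subset with two
  points, rules out the other.\<close>

lemma not_strict_mono_and_antimono:
  fixes f :: "real \<Rightarrow> real"
  assumes "a \<in> A" "b \<in> A" "a < b" "strict_mono_on A f" "strict_antimono_on A f"
  shows False
  using assms by (meson monotone_onD order_less_asym)

theorem theorem1:
  fixes \<alpha> :: real
  shows "(strict_mono_on {0<..1} (f_alpha \<alpha>) \<longleftrightarrow> \<alpha> \<ge> 2) \<and>
         (strict_antimono_on {0<..1} (f_alpha \<alpha>) \<longleftrightarrow> \<alpha> \<le> pi / 2) \<and>
         (pi / 2 < \<alpha> \<and> \<alpha> < 2 \<longrightarrow>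
           (\<exists>!x0. x0 \<in> {0<..<1} \<and> (\<forall>x\<in>{0<..<1}. f_alpha \<alpha> x0 \<le> f_alpha \<alpha> x)))"
proof -
  let ?I = "{0<..1::real}"
  have not_both: "\<not> (strict_mono_on ?I (f_alpha \<alpha>) \<and> strict_antimono_on ?I (f_alpha \<alpha>))"
    using not_strict_mono_and_antimono[of "1 / 2" ?I 1 "f_alpha \<alpha>"] by auto
  \<comment> \<open>The cases are mutually exclusive because \<open>pi < 4\<close>, so each one
    decides both equivalences.\<close>
  consider "\<alpha> \<ge> 2" | "\<alpha> \<le> pi / 2" | "pi / 2 < \<alpha>" "\<alpha> < 2" by linarith
  then show ?thesis
  proof cases
    case 1
    then show ?thesis
      using f_alpha_strict_mono not_both pi_less_4 by auto
  next
    case 2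
    then show ?thesis
      using f_alpha_strict_antimono not_both pi_less_4 by auto
  next
    case 3
    then obtain x0 where x0: "0 < x0" "x0 < 1"
      and dec: "strict_antimono_on {0<..x0} (f_alpha \<alpha>)"
      and inc: "strict_mono_on {x0..1} (f_alpha \<alpha>)"
      using f_alpha_valley by blast
    have sub: "{0<..x0} \<subseteq> ?I" "{x0..1} \<subseteq> ?I"
      using x0 by (simp_all add: subset_iff)
    \<comment> \<open>Restriction to one side of \<open>x0\<close> would contradict the opposite
      monotonicity there; the same argument on the other side follows.\<close>
    have "\<not> strict_mono_on ?I (f_alpha \<alpha>)"
      using not_strict_mono_and_antimono[of "x0 / 2" "{0<..x0}" x0 "f_alpha \<alpha>"] dec x0 sub(1)
        monotone_on_subset[of ?I "(<)" "(<)" "f_alpha \<alpha>" "{0<..x0}"] by auto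
    moreover have "\<not> strict_antimono_on ?I (f_alpha \<alpha>)"
      using not_strict_mono_and_antimono[of x0 "{x0..1}" 1 "f_alpha \<alpha>"] inc x0 sub(2)
        monotone_on_subset[of ?I "(<)" "(>)" "f_alpha \<alpha>" "{x0..1}"] by auto
    \<comment> \<open>Strictness away from \<open>x0\<close> yields both existence and uniqueness of
      the minimum point.\<close>
    moreover have min: "f_alpha \<alpha> x0 < f_alpha \<alpha> x" if "0 < x" "x < 1" "x \<noteq> x0" for x
      using monotone_onD[OF dec, of x x0] monotone_onD[OF inc, of x0 x] that x0 by fastforce
    have "\<exists>!x0. x0 \<in> {0<..<1} \<and> (\<forall>x\<in>{0<..<1}. f_alpha \<alpha> x0 \<le> f_alpha \<alpha> x)"
    proof (rule ex1I[of _ x0])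
      show "x0 \<in> {0<..<1} \<and> (\<forall>x\<in>{0<..<1}. f_alpha \<alpha> x0 \<le> f_alpha \<alpha> x)"
        using min x0 by (force intro: less_imp_le)
    next
      fix y assume y: "y \<in> {0<..<1} \<and> (\<forall>x\<in>{0<..<1}. f_alpha \<alpha> y \<le> f_alpha \<alpha> x)"
      show "y = x0"
        using min[of y] y x0 by force
    qed
    ultimately show ?thesis using 3 by auto
  qed
qed

end
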